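(* Let $G$ be a simple connected graph with vertex set $V(G)=\{t_1,\dots,t_n\}$, let $\mathbb{K}$ be a field, and let $\mathcal{N}_G\subseteq S=\mathbb{K}[t_1,\dots,t_n]$ be the closed neighborhood ideal of $G$. Then $$\mathtt{v}(\mathcal{N}_G)=\min\{\,|\mathtt{N}[U]\setminus D| \;:\; D \text{ is a minimal dominating set of } G \text{ and } U\subseteq \mathtt{P}_{\mathtt{N}}(D) \text{ dominates } D\,\}.$$
   Context: Graphs are finite and simple (no loops or multiple edges). The vertices of $G$ are identified with the variables $t_1,\dots,t_n$ of $S=\mathbb{K}[t_1,\dots,t_n]$, where $S=\bigoplus_{d\ge 0}S_d$ has the standard grading. For a vertex $v$, $\mathtt{N}(v)$ is the set of neighbors of $v$ and $\mathtt{N}[v]=\mathtt{N}(v)\cup\{v\}$. For $D\subseteq V(G)$, $\mathtt{N}(D)=\bigcup_{v\in D}\mathtt{N}(v)$ and $\mathtt{N}[D]=\mathtt{N}(D)\cup D$. A set $U\subseteq V(G)$ dominates a set $D\subseteq V(G)$ if $D\subseteq\mathtt{N}[U]$. A set $D$ is a dominating set of $G$ if $\mathtt{N}[D]=V(G)$; it is minimal if it does not properly contain another dominating set. For $D\subseteq V(G)$, $\mathtt{P}_{\mathtt{N}}(D)$ is the set of external and self-private neighbors of $D$, that is, the set of all $v\in V(G)$ with $|\mathtt{N}[v]\cap D|=1$ (such a $v$ is either outside $D$, or in $D$ and isolated in the induced subgraph $G[D]$). For $A\subseteq V(G)$, $\mathbf{t}_A=\prod_{t_j\in A}t_j$. The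 closed neighborhood ideal of $G$ is $\mathcal{N}_G=\langle \mathbf{t}_{\mathtt{N}[t_i]} : t_i\in V(G)\rangle\subseteq S$. For a graded ideal $I\subseteq S$, $(I:f)=\{g\in S : gf\in I\}$, $\operatorname{Ass}(I)$ is the set of associated primes of $S/I$, and the $\mathtt{v}$-number of $I$ is $$\mathtt{v}(I)=\min\{d\ge 0 : \exists\, f\in S_d \text{ and } \mathfrak{p}\in\operatorname{Ass}(I)\text{ with }(I:f)=\mathfrak{p}\}.$$ *)

theory Defs
  imports
    "HOL-Library.Poly_Mapping"
    "HOL-Algebra.Ideal"
    "Graph_Theory.Graph_Theory"
begin

section \<open>Polynomial rings over a field\<close>

text \<open>
  A polynomial with variables of type \<open>'v\<close> and coefficients of type \<open>'k\<close> is a finitely supported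
  map from exponent vectors to coefficients; an exponent vector is a finitely supported map from
  variables to natural numbers.  The arithmetic operations (multiplication being convolution) are
  the ones of \<^theory>\<open>HOL-Library.Poly_Mapping\<close>.
\<close>

type_synonym ('v, 'k) mpoly = "('v \<Rightarrow>\<^sub>0 nat) \<Rightarrow>\<^sub>0 'k"

text \<open>The ring \<open>S\<close> of the polynomials in which only variables from \<open>V\<close> occur.\<close>

definition mpoly_ring :: "'v set \<Rightarrow> ('v, 'k::field) mpoly ring" where
  "mpoly_ring V =
    \<lparr>carrier = {f. \<forall>m \<in> Poly_Mapping.keys f. Poly_Mapping.keys m \<subseteq> V},
     monoid.mult = (*), one = 1, ring.zero = 0, add = (+)\<rparr>"

definition mvar :: "'v \<Rightarrow> ('v, 'k::field) mpoly" where
  "mvar v = Poly_Mapping.single (Poly_Mapping.single v 1) 1"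

definition total_degree :: "('v \<Rightarrow>\<^sub>0 nat) \<Rightarrow> nat" where
  "total_degree m = (\<Sum>v \<in> Poly_Mapping.keys m. Poly_Mapping.lookup m v)"

text \<open>The graded component \<open>S\<^sub>d\<close>; it contains the zero polynomial.\<close>

definition graded_component :: "'v set \<Rightarrow> nat \<Rightarrow> ('v, 'k::field) mpoly set" where
  "graded_component V d =
    {f \<in> carrier (mpoly_ring V). \<forall>m \<in> Poly_Mapping.keys f. total_degree m = d}"

lemma cring_mpoly_ring: "cring (mpoly_ring V :: ('v, 'k::field) mpoly ring)"
proof (rule cringI)
  let ?S = "mpoly_ring V :: ('v, 'k) mpoly ring"
  show "abelian_group ?S"
  proof (rule abelian_groupI)
    fix x y assume "x \<in> carrier ?S" "y \<in> carrier ?S"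
    then show "x \<oplus>\<^bsub>?S\<^esub> y \<in> carrier ?S"
      using Poly_Mapping.keys_add[of x y] by (auto simp: mpoly_ring_def)
  next
    fix x assume "x \<in> carrier ?S"
    then show "\<exists>y\<in>carrier ?S. y \<oplus>\<^bsub>?S\<^esub> x = \<zero>\<^bsub>?S\<^esub>"
      by (intro bexI[of _ "- x"]) (auto simp: mpoly_ring_def)
  qed (auto simp: mpoly_ring_def algebra_simps)
  show "comm_monoid ?S"
  proof (rule comm_monoidI)
    fix x y assume xy: "x \<in> carrier ?S" "y \<in> carrier ?S"
    show "x \<otimes>\<^bsub>?S\<^esub> y \<in> carrier ?S"
      unfolding mpoly_ring_def
    proof (simp, intro ballI)
      fix m assume "m \<in> Poly_Mapping.keys (x * y)"
      then obtain a b where ab: "m = a + b" "a \<in> Poly_Mapping.keys x" "b \<in> Poly_Mapping.keys y"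
        using keys_mult[of x y] by auto
      then have "Poly_Mapping.keys a \<subseteq> V" "Poly_Mapping.keys b \<subseteq> V"
        using xy by (auto simp: mpoly_ring_def)
      then show "Poly_Mapping.keys m \<subseteq> V"
        using ab Poly_Mapping.keys_add[of a b] by auto
    qed
  qed (auto simp: mpoly_ring_def algebra_simps)
qed (auto simp: mpoly_ring_def algebra_simps)

section \<open>Colon ideals, associated primes and the v-number\<close>

definition colon :: "('a, 'b) ring_scheme \<Rightarrow> 'a set \<Rightarrow> 'a \<Rightarrow> 'a set" where
  "colon R I f = {g \<in> carrier R. g \<otimes>\<^bsub>R\<^esub> f \<in> I}"

text \<open>
  The associated primes of the \<open>R\<close>-module \<open>R/I\<close> are the prime ideals that are annihilators of an
  element of \<open>R/I\<close>; the annihilator of the class of \<open>f\<close> is \<^term>\<open>colon R I f\<close>.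
\<close>

definition Ass :: "('a, 'b) ring_scheme \<Rightarrow> 'a set \<Rightarrow> 'a set set" where
  "Ass R I = {P. primeideal P R \<and> (\<exists>f \<in> carrier R. P = colon R I f)}"

text \<open>Unspecified if no such degree exists, for instance for the unit ideal.\<close>

definition v_number :: "'v set \<Rightarrow> ('v, 'k::field) mpoly set \<Rightarrow> nat" where
  "v_number V I =
    (LEAST d. \<exists>f \<in> graded_component V d. \<exists>P \<in> Ass (mpoly_ring V) I. colon (mpoly_ring V) I f = P)"

section \<open>Domination in graphs\<close>

text \<open>
  Simple graphs are the graphs of type \<^typ>\<open>'v pair_pre_digraph\<close> satisfying
  \<^const>\<open>pair_graph\<close>: finite, with a symmetric and irreflexive set of arcs.
\<close>

definition nbhd :: "'v pair_pre_digraph \<Rightarrow> 'v \<Rightarrow> 'v set" where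
  "nbhd G v = {w. (v, w) \<in> parcs G}"

definition closed_nbhd :: "'v pair_pre_digraph \<Rightarrow> 'v \<Rightarrow> 'v set" where
  "closed_nbhd G v = nbhd G v \<union> {v}"

definition set_nbhd :: "'v pair_pre_digraph \<Rightarrow> 'v set \<Rightarrow> 'v set" where
  "set_nbhd G D = (\<Union>v \<in> D. nbhd G v)"

definition closed_set_nbhd :: "'v pair_pre_digraph \<Rightarrow> 'v set \<Rightarrow> 'v set" where
  "closed_set_nbhd G D = set_nbhd G D \<union> D"

definition set_dominates :: "'v pair_pre_digraph \<Rightarrow> 'v set \<Rightarrow> 'v set \<Rightarrow> bool" where
  "set_dominates G U D \<longleftrightarrow> U \<subseteq> pverts G \<and> D \<subseteq> pverts G \<and> D \<subseteq> closed_set_nbhd G U"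

definition dominating_set :: "'v pair_pre_digraph \<Rightarrow> 'v set \<Rightarrow> bool" where
  "dominating_set G D \<longleftrightarrow> D \<subseteq> pverts G \<and> closed_set_nbhd G D = pverts G"

definition minimal_dominating_set :: "'v pair_pre_digraph \<Rightarrow> 'v set \<Rightarrow> bool" where
  "minimal_dominating_set G D \<longleftrightarrow>
    dominating_set G D \<and> \<not> (\<exists>D'. D' \<subset> D \<and> dominating_set G D')"

definition private_nbrs :: "'v pair_pre_digraph \<Rightarrow> 'v set \<Rightarrow> 'v set" where
  "private_nbrs G D = {v \<in> pverts G. card (closed_nbhd G v \<inter> D) = 1}"

definition closed_nbhd_ideal :: "'v pair_pre_digraph \<Rightarrow> ('v, 'k::field) mpoly set" where
  "closed_nbhd_ideal G =
    genideal (mpoly_ring (pverts G)) {\<Prod>w \<in> closed_nbhd G v. mvar w | v. v \<in> pverts G}"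

end

theory Submission
  imports Defs
begin

text \<open>
  Everything rests on the shape of a prime colon ideal \<open>(I : f)\<close>, where \<open>I\<close> is generated by the
  squarefree monomials \<open>t\<^sub>A\<close> with \<open>A\<close> in a set family \<open>\<A>\<close>.  A polynomial lies in \<open>I\<close> iff the support
  of each of its monomials contains a member of \<open>\<A>\<close> (\<open>genideal_prod_mvar\<close>), so membership is a
  purely combinatorial matter.

  Suppose \<open>D\<close> meets every member of \<open>\<A>\<close> and \<open>T\<close> is a set disjoint from \<open>D\<close> such that every
  \<open>v \<in> D\<close> has an \<open>A \<in> \<A>\<close> with \<open>A \<subseteq> T \<union> {v}\<close>.  Then \<open>(I : t\<^sub>T)\<close> is the prime ideal generated by the
  variables in \<open>D\<close> (\<open>colon_prod_mvar_eq_variable_ideal\<close>), so the degree \<open>|T|\<close> is attained.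
  Conversely, let \<open>(I : f)\<close> be prime with \<open>f\<close> homogeneous of degree \<open>d\<close>, let \<open>D\<close> be the set of
  variables in \<open>(I : f)\<close>, and let \<open>T\<close> be the support of any monomial of \<open>f\<close> outside \<open>I\<close>.
  Then \<open>|T| \<le> d\<close>, and \<open>D\<close> and \<open>T\<close> have the properties above (\<open>prime_colon_witness\<close>).

  For the closed neighborhood ideal, \<open>\<A>\<close> consists of the closed neighborhoods.  A set meets all of
  them iff it is dominating, and the condition on \<open>T\<close> gives each \<open>v \<in> D\<close> a vertex whose closed
  neighborhood meets \<open>D\<close> in \<open>v\<close> only.  Such private neighbors make \<open>D\<close> minimal
  (\<open>minimal_dominating_set_iff\<close>), and if \<open>U\<close> is a set of them dominating \<open>D\<close>, the smallest
  \<open>T\<close> that serves this choice is \<open>N[U] - D\<close>.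
\<close>

section \<open>Monomials and products of polynomials\<close>

lemma keys_add_nat:
  "Poly_Mapping.keys (a + b) = Poly_Mapping.keys a \<union> Poly_Mapping.keys (b :: 'v \<Rightarrow>\<^sub>0 nat)"
  by (auto simp: in_keys_iff lookup_add)

text \<open>
  The convolution sum for the coefficient at \<open>a + b\<close> collapses to one term.  It suffices to
  control the first summand, since cancellation determines the second.
\<close>

lemma lookup_mult_unique_sum:
  fixes f g :: "'a::cancel_comm_monoid_add \<Rightarrow>\<^sub>0 'k::semiring_0"
  assumes "\<And>a' b'. \<lbrakk>a' \<in> Poly_Mapping.keys f; b' \<in> Poly_Mapping.keys g; a' + b' = a + b\<rbrakk> \<Longrightarrow> a' = a"
  shows "Poly_Mapping.lookup (f * g) (a + b) = Poly_Mapping.lookup f a * Poly_Mapping.lookup g b"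
proof -
  have "(\<lambda>l. Poly_Mapping.lookup f l * (\<Sum>q. Poly_Mapping.lookup g q when a + b = l + q)) =
        (\<lambda>l. Poly_Mapping.lookup f a * Poly_Mapping.lookup g b when l = a)"
  proof
    fix l
    show "Poly_Mapping.lookup f l * (\<Sum>q. Poly_Mapping.lookup g q when a + b = l + q) =
        (Poly_Mapping.lookup f a * Poly_Mapping.lookup g b when l = a)"
    proof (cases "l = a")
      case True
      then show ?thesis by simp
    next
      case False
      have "(Poly_Mapping.lookup g q when a + b = l + q) = 0" if "l \<in> Poly_Mapping.keys f" for q
        using assms[of l q] that False by (cases "q \<in> Poly_Mapping.keys g") (auto simp: when_def in_keys_iff)
      then show ?thesis using False by (cases "l \<in> Poly_Mapping.keys f") (auto simp: in_keys_iff)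
    qed
  qed
  then show ?thesis by (simp only: lookup_mult Sum_any_when_equal)
qed

text \<open>
  Leading monomials would provide such a pair, but the variables carry no linear order.  Instead
  the variables are treated one after the other: a sum of exponents that are maximal in \<open>F\<close> and in
  \<open>H\<close> for the variable \<open>x\<close> can only be formed from monomials with these maximal exponents, so
  both sets may be shrunk to the monomials on which \<open>x\<close> has maximal exponent, where the exponent of
  \<open>x\<close> is constant.
\<close>

lemma unique_sum_of_monomials:
  fixes F H :: "('v \<Rightarrow>\<^sub>0 nat) set"
  assumes "finite V" "finite F" "F \<noteq> {}" "finite H" "H \<noteq> {}"
    and "\<And>m. m \<in> F \<union> H \<Longrightarrow> Poly_Mapping.keys m \<subseteq> V"
  shows "\<exists>a\<in>F. \<exists>b\<in>H. \<forall>a'\<in>F. \<forall>b'\<in>H. a' + b' = a + b \<longrightarrow> a' = a"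
proof -
  (* The induction needs a hypothesis that survives shrinking F and H: the monomials of F agree
     outside the variables not yet treated.  When none is left, F is a singleton. *)
  have agree: "\<exists>a\<in>F. \<exists>b\<in>H. \<forall>a'\<in>F. \<forall>b'\<in>H. a' + b' = a + b \<longrightarrow> a' = a"
    if "finite V" "finite F" "F \<noteq> {}" "finite H" "H \<noteq> {}"
      and "\<forall>a\<in>F. \<forall>a'\<in>F. \<forall>v. v \<notin> V \<longrightarrow> Poly_Mapping.lookup a v = Poly_Mapping.lookup a' v"
    for V and F H :: "('v \<Rightarrow>\<^sub>0 nat) set"
    using that
  proof (induction V arbitrary: F H rule: finite_induct)
    case empty
    then have "\<forall>a\<in>F. \<forall>a'\<in>F. a = a'" by (auto intro!: poly_mapping_eqI)
    with empty show ?case by blast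
  next
    case (insert x V)
    let ?e = "\<lambda>m. Poly_Mapping.lookup m x"
    define F' where "F' = {a \<in> F. ?e a = Max (?e ` F)}"
    define H' where "H' = {b \<in> H. ?e b = Max (?e ` H)}"
    have maxF: "?e a \<le> Max (?e ` F)" if "a \<in> F" for a using insert.prems that by simp
    have maxH: "?e b \<le> Max (?e ` H)" if "b \<in> H" for b using insert.prems that by simp
    have "Max (?e ` F) \<in> ?e ` F" "Max (?e ` H) \<in> ?e ` H" using insert.prems by simp_all
    then have ne: "F' \<noteq> {}" "H' \<noteq> {}" by (auto simp: F'_def H'_def)
    have agr: "\<forall>a\<in>F'. \<forall>a'\<in>F'. \<forall>v. v \<notin> V \<longrightarrow> Poly_Mapping.lookup a v = Poly_Mapping.lookup a' v"
    proof (intro ballI allI impI)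
      fix a a' v assume "a \<in> F'" "a' \<in> F'" "v \<notin> V"
      then show "Poly_Mapping.lookup a v = Poly_Mapping.lookup a' v"
        using insert.prems(5) by (cases "v = x") (auto simp: F'_def)
    qed
    have "finite F'" "finite H'" using insert.prems by (auto simp: F'_def H'_def)
    then obtain a b where ab: "a \<in> F'" "b \<in> H'"
      "\<And>a' b'. \<lbrakk>a' \<in> F'; b' \<in> H'; a' + b' = a + b\<rbrakk> \<Longrightarrow> a' = a"
      using insert.IH[of F' H'] ne agr by blast
    have "a' = a" if "a' \<in> F" "b' \<in> H" "a' + b' = a + b" for a' b'
    proof -
      have "?e a' + ?e b' = Max (?e ` F) + Max (?e ` H)"
        using that(3) ab(1,2) by (metis (mono_tags, lifting) F'_def H'_def lookup_add mem_Collect_eq)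
      with maxF[OF that(1)] maxH[OF that(2)] have "a' \<in> F'" "b' \<in> H'"
        using that by (auto simp: F'_def H'_def)
      then show ?thesis using ab that by blast
    qed
    then show ?case using ab(1,2) unfolding F'_def H'_def by blast
  qed
  have "\<forall>a\<in>F. \<forall>a'\<in>F. \<forall>v. v \<notin> V \<longrightarrow> Poly_Mapping.lookup a v = Poly_Mapping.lookup a' v"
    using assms(6) by (metis UnI1 in_keys_iff subsetD)
  then show ?thesis using agree[OF assms(1-5)] by blast
qed

definition sum_vars :: "'v set \<Rightarrow> ('v \<Rightarrow>\<^sub>0 nat)" where
  "sum_vars A = (\<Sum>w\<in>A. Poly_Mapping.single w 1)"

lemma prod_mvar:
  assumes "finite A"
  shows "(\<Prod>w\<in>A. mvar w :: ('v, 'k::field) mpoly) =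
    Poly_Mapping.single (sum_vars A) 1"
  using assms unfolding sum_vars_def by induction (auto simp: mvar_def mult_single)

lemma lookup_sum_vars:
  assumes "finite A"
  shows "Poly_Mapping.lookup (sum_vars A) v = (if v \<in> A then 1 else 0)"
  using assms unfolding sum_vars_def by induction (auto simp: lookup_add lookup_single when_def)

lemma keys_sum_vars:
  assumes "finite A"
  shows "Poly_Mapping.keys (sum_vars A) = A"
  using assms by (auto simp: in_keys_iff lookup_sum_vars split: if_splits)

lemma keys_prod_mvar:
  assumes "finite A"
  shows "Poly_Mapping.keys (\<Prod>w\<in>A. mvar w :: ('v, 'k::field) mpoly) =
    {sum_vars A}"
  using assms by (simp add: prod_mvar)

lemma prod_mvar_in_graded_component:
  assumes "finite A" "A \<subseteq> V"
  shows "(\<Prod>w\<in>A. mvar w :: ('v, 'k::field) mpoly) \<in> graded_component V (card A)"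
proof -
  have "(\<Sum>v\<in>A. Poly_Mapping.lookup (sum_vars A) v) = (\<Sum>v\<in>A. 1)"
    using assms by (intro sum.cong) (auto simp: lookup_sum_vars)
  then show ?thesis
    using assms
    by (simp add: graded_component_def mpoly_ring_def keys_prod_mvar keys_sum_vars total_degree_def)
qed

lemma card_keys_le_total_degree: "card (Poly_Mapping.keys m) \<le> total_degree m"
proof -
  have "(\<Sum>v\<in>Poly_Mapping.keys m. 1) \<le> total_degree m"
    unfolding total_degree_def
    by (rule sum_mono) (metis One_nat_def Suc_leI gr0I in_keys_iff)
  then show ?thesis by simp
qed

section \<open>Squarefree monomial ideals\<close>

text \<open>
  Defined by its monomials rather than by generators, since membership is then decided one
  monomial at a time.
\<close>

definition squarefree_ideal :: "'v set \<Rightarrow> 'v set set \<Rightarrow> ('v, 'k::field) mpoly set" where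
  "squarefree_ideal V \<A> =
    {f \<in> carrier (mpoly_ring V). \<forall>m \<in> Poly_Mapping.keys f. \<exists>A \<in> \<A>. A \<subseteq> Poly_Mapping.keys m}"

lemma squarefree_ideal_mult:
  assumes "f \<in> squarefree_ideal V \<A>" "g \<in> carrier (mpoly_ring V)"
  shows "g * f \<in> squarefree_ideal V \<A>"
proof -
  interpret cring "mpoly_ring V" by (rule cring_mpoly_ring)
  have "g * f \<in> carrier (mpoly_ring V)"
    using m_closed[of g f] assms by (simp add: squarefree_ideal_def mpoly_ring_def)
  moreover have "\<exists>A \<in> \<A>. A \<subseteq> Poly_Mapping.keys m" if m: "m \<in> Poly_Mapping.keys (g * f)" for m
  proof -
    obtain a b where ab: "m = a + b" "b \<in> Poly_Mapping.keys f"
      using m keys_mult[of g f] by blast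
    then obtain A where "A \<in> \<A>" "A \<subseteq> Poly_Mapping.keys b"
      using assms(1) by (auto simp: squarefree_ideal_def)
    then show ?thesis unfolding ab(1) keys_add_nat by blast
  qed
  ultimately show ?thesis by (simp add: squarefree_ideal_def)
qed

lemma ideal_squarefree_ideal:
  "ideal (squarefree_ideal V \<A>) (mpoly_ring V :: ('v, 'k::field) mpoly ring)"
proof -
  let ?S = "mpoly_ring V :: ('v, 'k) mpoly ring"
  interpret S: cring ?S by (rule cring_mpoly_ring)
  have sub: "squarefree_ideal V \<A> \<subseteq> carrier ?S" by (auto simp: squarefree_ideal_def)
  show ?thesis
  proof (rule idealI)
    show "ring ?S" by (rule S.ring_axioms)
    show "subgroup (squarefree_ideal V \<A>) (add_monoid ?S)"
    proof (rule S.add.subgroupI)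
      show "squarefree_ideal V \<A> \<subseteq> carrier ?S" by (rule sub)
      have "0 \<in> (squarefree_ideal V \<A> :: ('v, 'k) mpoly set)"
        by (simp add: squarefree_ideal_def mpoly_ring_def)
      then show "squarefree_ideal V \<A> \<noteq> ({} :: ('v, 'k) mpoly set)" by blast
    next
      fix f :: "('v, 'k) mpoly" assume f: "f \<in> squarefree_ideal V \<A>"
      have "\<ominus>\<^bsub>?S\<^esub> f = - f"
        using f by (intro S.minus_equality) (auto simp: squarefree_ideal_def mpoly_ring_def)
      then show "\<ominus>\<^bsub>?S\<^esub> f \<in> squarefree_ideal V \<A>"
        using f by (simp add: squarefree_ideal_def mpoly_ring_def)
    next
      fix f g :: "('v, 'k) mpoly" assume "f \<in> squarefree_ideal V \<A>" "g \<in> squarefree_ideal V \<A>"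
      then show "f \<oplus>\<^bsub>?S\<^esub> g \<in> squarefree_ideal V \<A>"
        using Poly_Mapping.keys_add[of f g] by (simp add: squarefree_ideal_def mpoly_ring_def) blast
    qed
  next
    fix f g :: "('v, 'k) mpoly" assume "f \<in> squarefree_ideal V \<A>" "g \<in> carrier ?S"
    then show "g \<otimes>\<^bsub>?S\<^esub> f \<in> squarefree_ideal V \<A>" "f \<otimes>\<^bsub>?S\<^esub> g \<in> squarefree_ideal V \<A>"
      using squarefree_ideal_mult[of f V \<A> g] by (simp_all add: mpoly_ring_def mult.commute)
  qed
qed

lemma prod_mvar_in_squarefree_ideal_iff:
  assumes "finite T" "T \<subseteq> V"
  shows "(\<Prod>w\<in>T. mvar w :: ('v, 'k::field) mpoly) \<in> squarefree_ideal V \<A> \<longleftrightarrow> (\<exists>A\<in>\<A>. A \<subseteq> T)"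
  using assms by (simp add: squarefree_ideal_def keys_prod_mvar keys_sum_vars mpoly_ring_def)

text \<open>
  A monomial whose support contains \<open>A\<close> is divisible by \<open>t\<^sub>A\<close>; a polynomial all of whose
  monomials are of this kind is therefore a sum of multiples of the generators.
\<close>

lemma genideal_prod_mvar:
  assumes fin: "\<And>A. A \<in> \<A> \<Longrightarrow> finite A" and sub: "\<And>A. A \<in> \<A> \<Longrightarrow> A \<subseteq> V"
  shows "genideal (mpoly_ring V) {\<Prod>w\<in>A. mvar w | A. A \<in> \<A>} =
    (squarefree_ideal V \<A> :: ('v, 'k::field) mpoly set)"
proof -
  let ?S = "mpoly_ring V :: ('v, 'k) mpoly ring"
  let ?gens = "{\<Prod>w\<in>A. mvar w | A. A \<in> \<A>} :: ('v, 'k) mpoly set"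
  interpret S: cring ?S by (rule cring_mpoly_ring)
  have gens: "?gens \<subseteq> squarefree_ideal V \<A>"
  proof
    fix f assume "f \<in> ?gens"
    then obtain A where A: "A \<in> \<A>" "f = (\<Prod>w\<in>A. mvar w)" by blast
    then show "f \<in> squarefree_ideal V \<A>"
      using prod_mvar_in_squarefree_ideal_iff[OF fin sub] by auto
  qed
  then have gens_carrier: "?gens \<subseteq> carrier ?S" by (auto simp: squarefree_ideal_def)
  interpret J: ideal "genideal ?S ?gens" ?S by (rule S.genideal_ideal[OF gens_carrier])
  have single_mem: "Poly_Mapping.single m c \<in> genideal ?S ?gens"
    if A: "A \<in> \<A>" "A \<subseteq> Poly_Mapping.keys m" and m: "Poly_Mapping.keys m \<subseteq> V" for A m c
  proof -
    let ?e = "sum_vars A"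
    have m_eq: "m = (m - ?e) + ?e"
    proof (rule poly_mapping_eqI)
      fix v
      have "v \<in> A \<Longrightarrow> Poly_Mapping.lookup m v \<noteq> 0" using A(2) by (auto simp: in_keys_iff)
      then show "Poly_Mapping.lookup m v = Poly_Mapping.lookup ((m - ?e) + ?e) v"
        using fin[OF A(1)] by (simp add: lookup_add lookup_minus lookup_sum_vars)
    qed
    then have "Poly_Mapping.keys (m - ?e) \<subseteq> V"
      using m keys_add_nat[of "m - ?e" ?e] by auto
    then have "Poly_Mapping.single (m - ?e) c \<in> carrier ?S" by (simp add: mpoly_ring_def)
    moreover have "(\<Prod>w\<in>A. mvar w) \<in> genideal ?S ?gens"
      using S.genideal_self[OF gens_carrier] A(1) by blast
    ultimately have "Poly_Mapping.single (m - ?e) c * (\<Prod>w\<in>A. mvar w) \<in> genideal ?S ?gens"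
      using J.I_l_closed by (simp add: mpoly_ring_def)
    then show ?thesis
      using m_eq fin[OF A(1)] by (simp add: prod_mvar mult_single)
  qed
  have "f \<in> genideal ?S ?gens" if f: "f \<in> squarefree_ideal V \<A>" for f
  proof -
    have partial: "(\<Sum>m\<in>M. Poly_Mapping.single m (Poly_Mapping.lookup f m)) \<in> genideal ?S ?gens"
      if "finite M" "M \<subseteq> Poly_Mapping.keys f" for M
      using that
    proof (induction M rule: finite_induct)
      case empty
      then show ?case using J.zero_closed by (simp add: mpoly_ring_def)
    next
      case (insert m M)
      then have "Poly_Mapping.keys m \<subseteq> V" "\<exists>A\<in>\<A>. A \<subseteq> Poly_Mapping.keys m"
        using f by (auto simp: squarefree_ideal_def mpoly_ring_def)
      then have "Poly_Mapping.single m (Poly_Mapping.lookup f m) \<in> genideal ?S ?gens"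
        using single_mem by blast
      with insert show ?case using J.a_closed by (simp add: mpoly_ring_def)
    qed
    have expand: "(\<Sum>m\<in>Poly_Mapping.keys f. Poly_Mapping.single m (Poly_Mapping.lookup f m)) = f"
      by (rule poly_mapping_eqI)
        (auto simp: lookup_sum lookup_single when_def in_keys_iff sum.delta)
    show ?thesis using partial[OF finite_keys order_refl] unfolding expand .
  qed
  then show ?thesis
    using S.genideal_minimal[OF ideal_squarefree_ideal gens] by blast
qed

definition variable_ideal :: "'v set \<Rightarrow> 'v set \<Rightarrow> ('v, 'k::field) mpoly set" where
  "variable_ideal V D = squarefree_ideal V ((\<lambda>v. {v}) ` D)"

lemma mem_variable_ideal_iff:
  "f \<in> variable_ideal V D \<longleftrightarrow>
    f \<in> carrier (mpoly_ring V) \<and> (\<forall>m \<in> Poly_Mapping.keys f. Poly_Mapping.keys m \<inter> D \<noteq> {})"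
  by (auto simp: variable_ideal_def squarefree_ideal_def)

text \<open>
  The ideal is prime because the product of two polynomials outside it has a monomial free of
  \<open>D\<close>: among the monomials of the factors that are free of \<open>D\<close> there is a pair whose product arises
  only once, hence does not cancel.  Monomials involving \<open>D\<close> cannot interfere, as exponents only add up.
\<close>

lemma primeideal_variable_ideal:
  assumes "finite V"
  shows "primeideal (variable_ideal V D) (mpoly_ring V :: ('v, 'k::field) mpoly ring)"
proof (rule primeidealI)
  let ?S = "mpoly_ring V :: ('v, 'k) mpoly ring"
  show "ideal (variable_ideal V D) ?S"
    unfolding variable_ideal_def by (rule ideal_squarefree_ideal)
  show "cring ?S" by (rule cring_mpoly_ring)
  have "1 \<in> carrier ?S" "1 \<notin> (variable_ideal V D :: ('v, 'k) mpoly set)"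
    by (auto simp: mem_variable_ideal_iff mpoly_ring_def)
  then show "carrier ?S \<noteq> variable_ideal V D" by blast
next
  let ?S = "mpoly_ring V :: ('v, 'k) mpoly ring"
  fix f g :: "('v, 'k) mpoly"
  assume f: "f \<in> carrier ?S" and g: "g \<in> carrier ?S"
    and fg: "f \<otimes>\<^bsub>?S\<^esub> g \<in> variable_ideal V D"
  show "f \<in> variable_ideal V D \<or> g \<in> variable_ideal V D"
  proof (rule ccontr)
    assume nin: "\<not> ?thesis"
    define F where "F = {m \<in> Poly_Mapping.keys f. Poly_Mapping.keys m \<inter> D = {}}"
    define H where "H = {m \<in> Poly_Mapping.keys g. Poly_Mapping.keys m \<inter> D = {}}"
    have "finite F" "finite H" "F \<noteq> {}" "H \<noteq> {}" "\<And>m. m \<in> F \<union> H \<Longrightarrow> Poly_Mapping.keys m \<subseteq> V"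
      using nin f g by (auto simp: F_def H_def mem_variable_ideal_iff mpoly_ring_def)
    then obtain a b where ab: "a \<in> F" "b \<in> H"
      "\<And>a' b'. \<lbrakk>a' \<in> F; b' \<in> H; a' + b' = a + b\<rbrakk> \<Longrightarrow> a' = a"
      using unique_sum_of_monomials[OF assms, of F H] by blast
    have disj: "Poly_Mapping.keys (a + b) \<inter> D = {}"
      using ab by (auto simp: F_def H_def keys_add_nat)
    have "a' = a" if "a' \<in> Poly_Mapping.keys f" "b' \<in> Poly_Mapping.keys g" "a' + b' = a + b" for a' b'
    proof -
      have "(Poly_Mapping.keys a' \<union> Poly_Mapping.keys b') \<inter> D = {}"
        using disj that(3) by (metis keys_add_nat)
      then have "a' \<in> F" "b' \<in> H" using that by (auto simp: F_def H_def)
      then show ?thesis using ab(3) that(3) by blast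
    qed
    then have "Poly_Mapping.lookup (f * g) (a + b) = Poly_Mapping.lookup f a * Poly_Mapping.lookup g b"
      by (rule lookup_mult_unique_sum)
    then have "a + b \<in> Poly_Mapping.keys (f * g)"
      using ab by (simp add: F_def H_def in_keys_iff)
    then show False using fg disj by (auto simp: mem_variable_ideal_iff mpoly_ring_def)
  qed
qed

section \<open>The v-number of a squarefree monomial ideal\<close>

text \<open>
  The witnesses put \<open>v \<cdot> t\<^sub>T\<close> into the monomial ideal for each \<open>v \<in> D\<close>.  The colon ideal is no
  larger, because the monomial ideal is contained in the prime ideal of \<open>D\<close>, which does not contain
  \<open>t\<^sub>T\<close>.
\<close>

lemma colon_prod_mvar_eq_variable_ideal:
  assumes V: "finite V" and D: "D \<subseteq> V" and T: "T \<subseteq> V" "T \<inter> D = {}"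
    and cover: "\<And>A. A \<in> \<A> \<Longrightarrow> A \<inter> D \<noteq> {}"
    and witness: "\<And>v. v \<in> D \<Longrightarrow> \<exists>A\<in>\<A>. A \<subseteq> insert v T"
  shows "colon (mpoly_ring V) (squarefree_ideal V \<A>) (\<Prod>w\<in>T. mvar w) =
    (variable_ideal V D :: ('v, 'k::field) mpoly set)"
proof
  let ?S = "mpoly_ring V :: ('v, 'k) mpoly ring"
  let ?t = "\<Prod>w\<in>T. mvar w :: ('v, 'k) mpoly"
  let ?e = "sum_vars T"
  have finT: "finite T" using V T finite_subset by blast
  have t: "?t \<in> carrier ?S" "?t \<notin> variable_ideal V D"
    using finT T by (auto simp: mem_variable_ideal_iff mpoly_ring_def keys_prod_mvar keys_sum_vars)
  interpret P: primeideal "variable_ideal V D" ?S by (rule primeideal_variable_ideal[OF V])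
  have "squarefree_ideal V \<A> \<subseteq> (variable_ideal V D :: ('v, 'k) mpoly set)"
    using cover unfolding squarefree_ideal_def mem_variable_ideal_iff subset_iff by fastforce
  then show "colon ?S (squarefree_ideal V \<A>) ?t \<subseteq> variable_ideal V D"
    using P.I_prime t by (auto simp: colon_def)
  show "variable_ideal V D \<subseteq> colon ?S (squarefree_ideal V \<A>) ?t"
  proof
    fix g :: "('v, 'k) mpoly" assume g: "g \<in> variable_ideal V D"
    have gS: "g \<in> carrier ?S" using g by (simp add: mem_variable_ideal_iff)
    have "\<exists>A\<in>\<A>. A \<subseteq> Poly_Mapping.keys m" if m: "m \<in> Poly_Mapping.keys (g * ?t)" for m
    proof -
      obtain a where a: "a \<in> Poly_Mapping.keys g" "m = a + ?e"
        using m keys_mult[of g ?t] finT by (auto simp: keys_prod_mvar)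
      then obtain v where v: "v \<in> Poly_Mapping.keys a" "v \<in> D"
        using g by (auto simp: mem_variable_ideal_iff)
      moreover have "Poly_Mapping.keys m = Poly_Mapping.keys a \<union> T"
        using a(2) finT by (simp add: keys_add_nat keys_sum_vars)
      ultimately show ?thesis using witness[OF v(2)] by blast
    qed
    moreover have "g * ?t \<in> carrier ?S"
      using P.m_closed[OF gS t(1)] by (simp add: mpoly_ring_def)
    ultimately show "g \<in> colon ?S (squarefree_ideal V \<A>) ?t"
      using gS by (auto simp: colon_def squarefree_ideal_def mpoly_ring_def)
  qed
qed

lemma (in primeideal) prod_mem_primeideal:
  assumes "finite A" "\<And>a. a \<in> A \<Longrightarrow> x a \<in> carrier R" "finprod R x A \<in> I"
  shows "\<exists>a\<in>A. x a \<in> I"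
  using assms
proof (induction A rule: finite_induct)
  case empty
  then show ?case using I_notcarr one_imp_carrier by simp
next
  case (insert a A)
  then have "x a \<otimes> finprod R x A \<in> I" by simp
  then show ?case using insert I_prime by (metis (full_types) Pi_I finprod_closed insert_iff)
qed

lemma finprod_mpoly_ring:
  assumes "finite A" "\<And>a. a \<in> A \<Longrightarrow> x a \<in> carrier (mpoly_ring V)"
  shows "finprod (mpoly_ring V) x A = (\<Prod>a\<in>A. x a :: ('v, 'k::field) mpoly)"
proof -
  interpret cring "mpoly_ring V :: ('v, 'k) mpoly ring" by (rule cring_mpoly_ring)
  show ?thesis
    using assms
  proof (induction A rule: finite_induct)
    case empty
    then show ?case using finprod_empty[of x] by (simp add: mpoly_ring_def)
  next
    case (insert a A)
    then have "finprod (mpoly_ring V) x (insert a A) = x a \<otimes>\<^bsub>mpoly_ring V\<^esub> finprod (mpoly_ring V) x A"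
      by (intro finprod_insert) auto
    moreover have "finprod (mpoly_ring V) x A = prod x A" using insert by blast
    ultimately show ?case using insert.hyps by (simp add: mpoly_ring_def)
  qed
qed

text \<open>
  The converse of the preceding construction.  Primality enters only to find a variable of each
  generator in the colon ideal, and properness to find a monomial of \<open>f\<close> outside the
  monomial ideal.
\<close>

lemma prime_colon_witness:
  fixes f :: "('v, 'k::field) mpoly"
  assumes f: "f \<in> graded_component V d"
    and prime: "primeideal (colon (mpoly_ring V) (squarefree_ideal V \<A>) f) (mpoly_ring V)"
    and fin: "\<And>A. A \<in> \<A> \<Longrightarrow> finite A" and sub: "\<And>A. A \<in> \<A> \<Longrightarrow> A \<subseteq> V"
  obtains D T where "D \<subseteq> V" "T \<subseteq> V" "finite T" "T \<inter> D = {}" "card T \<le> d"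
    "\<And>A. A \<in> \<A> \<Longrightarrow> A \<inter> D \<noteq> {}"
    "\<And>v. v \<in> D \<Longrightarrow> \<exists>A\<in>\<A>. v \<in> A \<and> A \<subseteq> insert v T"
proof -
  let ?S = "mpoly_ring V :: ('v, 'k) mpoly ring"
  let ?I = "squarefree_ideal V \<A> :: ('v, 'k) mpoly set"
  interpret P: primeideal "colon ?S ?I f" ?S by (rule prime)
  have fS: "f \<in> carrier ?S" using f by (simp add: graded_component_def)
  have "f \<notin> ?I"
  proof
    assume "f \<in> ?I"
    then have "colon ?S ?I f = carrier ?S"
      using squarefree_ideal_mult by (auto simp: colon_def mpoly_ring_def)
    then show False using P.I_notcarr by simp
  qed
  then obtain m where m: "m \<in> Poly_Mapping.keys f" "\<And>A. A \<in> \<A> \<Longrightarrow> \<not> A \<subseteq> Poly_Mapping.keys m"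
    using fS by (auto simp: squarefree_ideal_def)
  define D where "D = {v \<in> V. mvar v \<in> colon ?S ?I f}"
  (* The monomial m becomes a member of the ideal once multiplied by v, so a generator dividing
     the product cannot avoid v. *)
  have wit: "\<exists>A\<in>\<A>. v \<in> A \<and> A \<subseteq> insert v (Poly_Mapping.keys m)" if "v \<in> D" for v
  proof -
    have "mvar v * f \<in> ?I" using that by (simp add: D_def colon_def mpoly_ring_def)
    moreover have "Poly_Mapping.lookup (mvar v * f) (Poly_Mapping.single v 1 + m) =
        Poly_Mapping.lookup (mvar v :: ('v, 'k) mpoly) (Poly_Mapping.single v 1) * Poly_Mapping.lookup f m"
      by (rule lookup_mult_unique_sum) (simp add: mvar_def)
    then have "Poly_Mapping.single v 1 + m \<in> Poly_Mapping.keys (mvar v * f)"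
      using m(1) by (simp add: in_keys_iff mvar_def)
    ultimately obtain A where A: "A \<in> \<A>" "A \<subseteq> Poly_Mapping.keys (Poly_Mapping.single v 1 + m)"
      by (auto simp: squarefree_ideal_def simp del: One_nat_def)
    then have "A \<subseteq> insert v (Poly_Mapping.keys m)" by (simp add: keys_add_nat)
    moreover from this have "v \<in> A" using m(2)[OF A(1)] by blast
    ultimately show ?thesis using A(1) by blast
  qed
  have cover: "A \<inter> D \<noteq> {}" if A: "A \<in> \<A>" for A
  proof -
    have vars: "(mvar w :: ('v, 'k) mpoly) \<in> carrier ?S" if "w \<in> A" for w
      using that sub[OF A] by (auto simp: mvar_def mpoly_ring_def)
    have "(\<Prod>w\<in>A. mvar w) \<in> ?I"
      using prod_mvar_in_squarefree_ideal_iff[OF fin[OF A] sub[OF A]] A by blast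
    moreover from this have "f * (\<Prod>w\<in>A. mvar w) \<in> ?I"
      by (rule squarefree_ideal_mult[OF _ fS])
    ultimately have "finprod ?S mvar A \<in> colon ?S ?I f"
      using finprod_mpoly_ring[OF fin[OF A] vars]
      by (simp add: colon_def mpoly_ring_def squarefree_ideal_def mult.commute)
    then obtain w where "w \<in> A" "mvar w \<in> colon ?S ?I f"
      using P.prod_mem_primeideal[OF fin[OF A]] vars by blast
    then show ?thesis using sub[OF A] by (auto simp: D_def)
  qed
  show thesis
  proof
    show "D \<subseteq> V" by (auto simp: D_def)
    show "Poly_Mapping.keys m \<subseteq> V" using fS m(1) by (auto simp: mpoly_ring_def)
    show "Poly_Mapping.keys m \<inter> D = {}" using wit m(2) by (metis disjoint_iff insert_absorb)
    show "card (Poly_Mapping.keys m) \<le> d"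
      using card_keys_le_total_degree[of m] f m(1) by (simp add: graded_component_def)
  qed (use cover wit in auto)
qed

section \<open>Minimal dominating sets and private neighbors\<close>

lemma (in pair_graph) mem_closed_nbhd_commute:
  "w \<in> closed_nbhd G v \<longleftrightarrow> v \<in> closed_nbhd G w"
  using pair_sym_arcs
  by (auto simp: closed_nbhd_def nbhd_def arcs_symmetric)

lemma (in pair_graph) closed_nbhd_subset: "v \<in> pverts G \<Longrightarrow> closed_nbhd G v \<subseteq> pverts G"
  using arc_snd_in_verts by (fastforce simp: closed_nbhd_def nbhd_def)

lemma closed_set_nbhd_eq: "closed_set_nbhd G U = (\<Union>u\<in>U. closed_nbhd G u)"
  by (auto simp: closed_set_nbhd_def set_nbhd_def closed_nbhd_def)

lemma (in pair_graph) dominating_set_iff: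
  "dominating_set G D \<longleftrightarrow> D \<subseteq> pverts G \<and> (\<forall>v\<in>pverts G. closed_nbhd G v \<inter> D \<noteq> {})"
proof (cases "D \<subseteq> pverts G")
  case True
  then have "closed_set_nbhd G D \<subseteq> pverts G"
    using closed_nbhd_subset by (auto simp: closed_set_nbhd_eq)
  then have "dominating_set G D \<longleftrightarrow> pverts G \<subseteq> closed_set_nbhd G D"
    using True by (auto simp: dominating_set_def)
  also have "\<dots> \<longleftrightarrow> (\<forall>v\<in>pverts G. closed_nbhd G v \<inter> D \<noteq> {})"
    unfolding closed_set_nbhd_eq using mem_closed_nbhd_commute by blast
  finally show ?thesis using True by blast
qed (auto simp: dominating_set_def)

lemma (in pair_graph) mem_private_nbrs_iff:
  "u \<in> private_nbrs G D \<longleftrightarrow> u \<in> pverts G \<and> (\<exists>v. closed_nbhd G u \<inter> D = {v})"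
  by (auto simp: private_nbrs_def card_1_singleton_iff)

text \<open>
  Removing \<open>v\<close> from a dominating set leaves a closed neighborhood without representative exactly if
  \<open>v\<close> was the only one there; and if no single vertex can be removed, then no proper subset dominates.
\<close>

lemma (in pair_graph) minimal_dominating_set_iff:
  "minimal_dominating_set G D \<longleftrightarrow>
    dominating_set G D \<and> (\<forall>v\<in>D. \<exists>u\<in>pverts G. closed_nbhd G u \<inter> D = {v})"
proof (intro iffI conjI ballI)
  assume D: "minimal_dominating_set G D"
  then show dom: "dominating_set G D" by (simp add: minimal_dominating_set_def)
  fix v assume v: "v \<in> D"
  then have "\<not> dominating_set G (D - {v})"
    using D unfolding minimal_dominating_set_def by blast
  then obtain u where u: "u \<in> pverts G" "closed_nbhd G u \<inter> (D - {v}) = {}"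
    using dom by (auto simp: dominating_set_iff)
  then have "closed_nbhd G u \<inter> D = {v}" using dom by (auto simp: dominating_set_iff)
  then show "\<exists>u\<in>pverts G. closed_nbhd G u \<inter> D = {v}" using u(1) by blast
next
  assume D: "dominating_set G D \<and> (\<forall>v\<in>D. \<exists>u\<in>pverts G. closed_nbhd G u \<inter> D = {v})"
  show "minimal_dominating_set G D"
    unfolding minimal_dominating_set_def
  proof (intro conjI notI)
    show "dominating_set G D" using D by blast
    assume "\<exists>D'. D' \<subset> D \<and> dominating_set G D'"
    then obtain D' v where "D' \<subset> D" "dominating_set G D'" "v \<in> D" "v \<notin> D'" by blast
    moreover obtain u where "u \<in> pverts G" "closed_nbhd G u \<inter> D = {v}" using D \<open>v \<in> D\<close> by blast
    moreover from calculation have "closed_nbhd G u \<inter> D' \<noteq> {}" by (simp add: dominating_set_iff)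
    ultimately show False by fastforce
  qed
qed

lemma (in pair_graph) minimal_dominating_set_exists: "\<exists>D. minimal_dominating_set G D"
proof -
  have "dominating_set G (pverts G)" by (auto simp: dominating_set_iff closed_nbhd_def)
  then have "{D. dominating_set G D} \<noteq> {}" by blast
  moreover have "finite {D. dominating_set G D}"
    using pair_finite_verts by (auto simp: dominating_set_def)
  ultimately obtain D where "D \<in> {D. dominating_set G D}"
    "\<forall>D'\<in>{D. dominating_set G D}. D' \<subseteq> D \<longrightarrow> D = D'"
    using finite_has_minimal by blast
  then show ?thesis unfolding minimal_dominating_set_def by blast
qed

text \<open>
  With the existence of minimal dominating sets, this shows that the minimum in the theorem is
  taken over a nonempty set.
\<close>

lemma (in pair_graph) private_nbrs_dominate:
  assumes "minimal_dominating_set G D"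
  shows "set_dominates G (private_nbrs G D) D"
proof -
  have "D \<subseteq> pverts G" "\<And>v. v \<in> D \<Longrightarrow> \<exists>u\<in>pverts G. closed_nbhd G u \<inter> D = {v}"
    using assms by (auto simp: minimal_dominating_set_iff dominating_set_def)
  then show ?thesis
    by (fastforce simp: set_dominates_def closed_set_nbhd_eq mem_private_nbrs_iff)
qed

lemma (in pair_graph) closed_nbhd_ideal_eq:
  "closed_nbhd_ideal G = (squarefree_ideal (pverts G) (closed_nbhd G ` pverts G) :: ('a, 'k::field) mpoly set)"
proof -
  have "{\<Prod>w \<in> closed_nbhd G v. mvar w | v. v \<in> pverts G} =
    ({\<Prod>w\<in>A. mvar w | A. A \<in> closed_nbhd G ` pverts G} :: ('a, 'k) mpoly set)" by auto
  moreover have "finite A" "A \<subseteq> pverts G" if "A \<in> closed_nbhd G ` pverts G" for A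
    using that closed_nbhd_subset pair_finite_verts finite_subset by blast+
  ultimately show ?thesis unfolding closed_nbhd_ideal_def by (simp add: genideal_prod_mvar)
qed

text \<open>
  The monomial \<open>t\<^sub>T\<close> with \<open>T = N[U] - D\<close> works: a vertex \<open>u \<in> U\<close> adjacent or equal to \<open>v \<in> D\<close> has
  \<open>v\<close> as its only closed neighbor in \<open>D\<close>, so all its other closed neighbors lie in \<open>T\<close>.
\<close>

lemma (in pair_graph) private_dominator_gives_degree:
  assumes D: "minimal_dominating_set G D" and U: "U \<subseteq> private_nbrs G D" "set_dominates G U D"
  shows "\<exists>f \<in> graded_component (pverts G) (card (closed_set_nbhd G U - D)).
    \<exists>P \<in> Ass (mpoly_ring (pverts G)) (closed_nbhd_ideal G :: ('a, 'k::field) mpoly set).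
      colon (mpoly_ring (pverts G)) (closed_nbhd_ideal G) f = P"
proof -
  let ?T = "closed_set_nbhd G U - D"
  let ?f = "\<Prod>w\<in>?T. mvar w :: ('a, 'k) mpoly"
  have DV: "D \<subseteq> pverts G" and dom: "\<And>v. v \<in> pverts G \<Longrightarrow> closed_nbhd G v \<inter> D \<noteq> {}"
    using D by (auto simp: minimal_dominating_set_iff dominating_set_iff)
  have UV: "U \<subseteq> pverts G" using U(2) by (simp add: set_dominates_def)
  then have T: "?T \<subseteq> pverts G" using closed_nbhd_subset by (auto simp: closed_set_nbhd_eq)
  have "\<exists>A\<in>closed_nbhd G ` pverts G. A \<subseteq> insert v ?T" if v: "v \<in> D" for v
  proof -
    obtain u where u: "u \<in> U" "v \<in> closed_nbhd G u"
      using U(2) v by (auto simp: set_dominates_def closed_set_nbhd_eq)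
    moreover obtain v' where "closed_nbhd G u \<inter> D = {v'}"
      using U(1) u(1) mem_private_nbrs_iff by blast
    ultimately have "closed_nbhd G u \<inter> D = {v}" using v by (metis IntI singletonD)
    then have "closed_nbhd G u \<subseteq> insert v ?T" using u(1) by (auto simp: closed_set_nbhd_eq)
    then show ?thesis using u(1) UV by blast
  qed
  then have eq: "colon (mpoly_ring (pverts G)) (closed_nbhd_ideal G) ?f = variable_ideal (pverts G) D"
    unfolding closed_nbhd_ideal_eq using dom DV T pair_finite_verts
    by (intro colon_prod_mvar_eq_variable_ideal) auto
  have f: "?f \<in> graded_component (pverts G) (card ?T)"
    using T pair_finite_verts finite_subset by (blast intro: prod_mvar_in_graded_component)
  then have "?f \<in> carrier (mpoly_ring (pverts G))" by (simp add: graded_component_def)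
  then have "variable_ideal (pverts G) D \<in>
      Ass (mpoly_ring (pverts G)) (closed_nbhd_ideal G :: ('a, 'k) mpoly set)"
    unfolding Ass_def using eq primeideal_variable_ideal[OF pair_finite_verts] by blast
  then show ?thesis using f eq by blast
qed

text \<open>
  The sets \<open>D\<close> and \<open>T\<close> extracted from \<open>f\<close> determine \<open>U\<close>: all vertices whose closed neighborhood
  is covered by \<open>T\<close> and one vertex of \<open>D\<close>.  Then \<open>N[U] - D\<close> stays inside \<open>T\<close>.
\<close>

lemma (in pair_graph) degree_bounds_private_dominator:
  fixes f :: "('a, 'k::field) mpoly"
  assumes f: "f \<in> graded_component (pverts G) d"
    and prime: "primeideal (colon (mpoly_ring (pverts G)) (closed_nbhd_ideal G) f) (mpoly_ring (pverts G))"
  shows "\<exists>D U. minimal_dominating_set G D \<and> U \<subseteq> private_nbrs G D \<and> set_dominates G U D \<and>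
    card (closed_set_nbhd G U - D) \<le> d"
proof -
  have fin: "finite A" and sub: "A \<subseteq> pverts G" if "A \<in> closed_nbhd G ` pverts G" for A
    using that closed_nbhd_subset pair_finite_verts finite_subset by blast+
  obtain D T where DT: "D \<subseteq> pverts G" "T \<subseteq> pverts G" "finite T" "T \<inter> D = {}" "card T \<le> d"
    and dom: "\<And>A. A \<in> closed_nbhd G ` pverts G \<Longrightarrow> A \<inter> D \<noteq> {}"
    and wit: "\<And>v. v \<in> D \<Longrightarrow> \<exists>A\<in>closed_nbhd G ` pverts G. v \<in> A \<and> A \<subseteq> insert v T"
    using prime_colon_witness[OF f prime[unfolded closed_nbhd_ideal_eq] fin sub] by metis
  have priv: "\<exists>u\<in>pverts G. closed_nbhd G u \<inter> D = {v} \<and> closed_nbhd G u \<subseteq> insert v T" if "v \<in> D" for v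
    using wit[OF that] DT(4) that by blast
  define U where "U = {u \<in> pverts G. \<exists>v\<in>D. closed_nbhd G u \<inter> D = {v} \<and> closed_nbhd G u \<subseteq> insert v T}"
  have "minimal_dominating_set G D"
    using DT(1) dom priv by (auto simp: minimal_dominating_set_iff dominating_set_iff) blast
  moreover have "U \<subseteq> private_nbrs G D" by (auto simp: U_def mem_private_nbrs_iff)
  moreover have "set_dominates G U D"
    unfolding set_dominates_def closed_set_nbhd_eq using DT(1) priv by (fastforce simp: U_def)
  moreover have "closed_set_nbhd G U - D \<subseteq> T" by (auto simp: closed_set_nbhd_eq U_def)
  then have "card (closed_set_nbhd G U - D) \<le> d" using DT(3,5) card_mono le_trans by blast
  ultimately show ?thesis by blast
qed

theorem theorem3p6:
  fixes G :: "'v pair_pre_digraph"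
  assumes "pair_graph G"
    and "Digraph_Component.connected (with_proj G)"
  shows "v_number (pverts G) (closed_nbhd_ideal G :: ('v, 'k::field) mpoly set) =
    Min {card (closed_set_nbhd G U - D) | D U.
      minimal_dominating_set G D \<and> U \<subseteq> private_nbrs G D \<and> set_dominates G U D}"
proof -
  interpret pair_graph G by (rule assms(1))
  let ?Q = "\<lambda>d. \<exists>f \<in> graded_component (pverts G) d.
    \<exists>P \<in> Ass (mpoly_ring (pverts G)) (closed_nbhd_ideal G :: ('v, 'k) mpoly set).
      colon (mpoly_ring (pverts G)) (closed_nbhd_ideal G) f = P"
  let ?M = "{card (closed_set_nbhd G U - D) | D U.
      minimal_dominating_set G D \<and> U \<subseteq> private_nbrs G D \<and> set_dominates G U D}"
  have "?M \<subseteq> (\<lambda>(D, U). card (closed_set_nbhd G U - D)) ` (Pow (pverts G) \<times> Pow (pverts G))"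
    by (auto simp: set_dominates_def)
  then have fin: "finite ?M" using pair_finite_verts by (meson finite_Pow_iff finite_SigmaI finite_surj)
  have ne: "?M \<noteq> {}" using minimal_dominating_set_exists private_nbrs_dominate by blast
  have "(LEAST d. ?Q d) = Min ?M"
  proof (rule Least_equality)
    have "Min ?M \<in> ?M" by (rule Min_in[OF fin ne])
    then obtain D U where "minimal_dominating_set G D" "U \<subseteq> private_nbrs G D" "set_dominates G U D"
      and "Min ?M = card (closed_set_nbhd G U - D)" by blast
    then show "?Q (Min ?M)" using private_dominator_gives_degree[of D U, where ?'k = 'k] by presburger
  next
    fix d assume "?Q d"
    then obtain f :: "('v, 'k) mpoly" where "f \<in> graded_component (pverts G) d"
      "primeideal (colon (mpoly_ring (pverts G)) (closed_nbhd_ideal G) f) (mpoly_ring (pverts G))"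
      by (auto simp: Ass_def)
    then obtain D U where "minimal_dominating_set G D" "U \<subseteq> private_nbrs G D" "set_dominates G U D"
      and le: "card (closed_set_nbhd G U - D) \<le> d"
      using degree_bounds_private_dominator by blast
    then have "card (closed_set_nbhd G U - D) \<in> ?M" by blast
    then show "Min ?M \<le> d" using Min_le[OF fin] le order_trans by blast
  qed
  then show ?thesis by (simp add: v_number_def)
qed

end
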